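(* Let $\ell,N<\infty$ be positive integers and let $K(x,x')=\sum_{i=1}^{\ell}\lambda_i\phi_i(x)\phi_i(x')$ be a Mercer kernel on $(\mathcal{X},\mu)$ with exactly $\ell$ terms (that is, $\ell_{GP}=\ell$). Let $\mathcal{Q}_\ell=\{(x_k,w_k):k=1,\dots,N\}$ be a quadrature rule that orthogonalizes the functions $\psi_i=\phi_i$, $i=1,\dots,\ell$. Let $f:\mathcal{X}\to\mathbb{R}$ and $\bm{y}=[f(x_1),\dots,f(x_N)]^T$. Let $\hat f_\ell$ be the pseudospectral approximation of $f$ with basis $\{\psi_1,\dots,\psi_\ell\}$ computed with $\mathcal{Q}_\ell$, and let $m$ be the posterior mean of Gaussian process regression with zero prior mean, prior covariance kernel $K$ and nugget $\sigma^2>0$, constructed from the function evaluations $\bm{y}$ at the nodes of $\mathcal{Q}_\ell$. Let $$M=\max_{(x,w)\in\mathcal{Q}_\ell,\ i\in\{1,\dots,\ell\}}|\psi_i(x)|,\qquad w_{\max}=\max_{i\in\{1,\dots,N\}}|w_i|,$$ and let $s_N$ be the smallest eigenvalue of the matrix $[K(x_i,x_j)]_{i,j=1}^N$. Then $$\Vert m-\hat f_\ell\Vert_{L^2_\mu}^2\le\Vert\bm{y}\Vert_2^2\,\ell N M^2w_{\max}^2\left(\frac{\sigma^2}{s_N+\sigma^2}\right)^2.$$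
   Context: Mercer kernel: $\mathcal{X}\subseteq\mathbb{R}^d$ is first countable and endowed with a strictly positive Borel measure $\mu$; $K:\mathcal{X}\times\mathcal{X}\to\mathbb{R}$ is continuous, symmetric, positive semidefinite in the sense that $\int_{\mathcal{X}\times\mathcal{X}} K(x,x')g(x)g(x')\,d\mu(x)d\mu(x')\ge 0$ for all $g\in L^2_\mu(\mathcal{X})$, and $\int_{\mathcal{X}}|K(x,x)|\,d\mu(x)<\infty$. The $\lambda_i\ge0$ are the eigenvalues and the $\phi_i$ the eigenfunctions (orthonormal in $L^2_\mu(\mathcal{X})$, real-valued, defined pointwise) of the integral operator $T_Kg=\int_{\mathcal{X}} K(x,x')g(x')\,d\mu(x')$. Orthogonalizing rule: nodes $x_k\in\mathcal{X}$ and weights $w_k\in\mathbb{R}$, $k=1,\dots,N$, orthogonalize $\psi_1,\dots,\psi_\ell$ if $\sum_{k=1}^N w_k\psi_i(x_k)\psi_j(x_k)=\int\psi_i\psi_j\,d\mu=\delta_{ij}$ for all $i,j=1,\dots,\ell$. Pseudospectral approximation: $\hat f_\ell(x)=\sum_{i=1}^\ell\left(\sum_{k=1}^N w_kf(x_k)\psi_i(x_k)\right)\psi_i(x)$. Gaussian process posterior mean (zero prior mean): $m(x)=\bm{y}^T\mathbf{R}\,K(\bm{x},x)$, where $K(\bm{x},x)=[K(x_1,x),\dots,K(x_N,x)]^T$ and $\mathbf{R}$ is the inverse of the $N\times N$ matrix with entries $K(x_i,x_j)+\delta_{ij}\sigma^2$. $\Vert\bm{y}\Vert_2$ is the Euclidean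 norm. *)

theory Defs
  imports "HOL-Analysis.Analysis"
begin

text \<open>
  The number of quadrature nodes and the number of basis functions are the cardinalities of the
  finite index types \<open>'n\<close> and \<open>'l\<close>; both are positive because types are nonempty.
  Functions on a set \<open>X\<close> are total functions whose values outside \<open>X\<close> are irrelevant.
\<close>

section \<open>Mercer kernels\<close>

text \<open>
  The Borel sets of \<open>X\<close> are those of its subspace topology; the equation on the
  sets of the measure also forces its space to be \<open>X\<close>.
\<close>

definition strictly_positive_borel :: "(real^'d) set \<Rightarrow> (real^'d) measure \<Rightarrow> bool" where
  "strictly_positive_borel X \<mu> \<longleftrightarrow>
     first_countable (top_of_set X) \<and>
     sets \<mu> = sets (restrict_space borel X) \<and>
     (\<forall>U. openin (top_of_set X) U \<and> U \<noteq> {} \<longrightarrow> 0 < emeasure \<mu> U)"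

definition L2 :: "'a measure \<Rightarrow> ('a \<Rightarrow> real) set" where
  "L2 \<mu> = {g \<in> borel_measurable \<mu>. integrable \<mu> (\<lambda>x. (g x)\<^sup>2)}"

definition L2_norm :: "'a measure \<Rightarrow> ('a \<Rightarrow> real) \<Rightarrow> real" where
  "L2_norm \<mu> g = sqrt (\<integral>x. (g x)\<^sup>2 \<partial>\<mu>)"

definition integral_operator :: "'a measure \<Rightarrow> ('a \<Rightarrow> 'a \<Rightarrow> real) \<Rightarrow> ('a \<Rightarrow> real) \<Rightarrow> 'a \<Rightarrow> real" where
  "integral_operator \<mu> K g = (\<lambda>x. \<integral>x'. K x x' * g x' \<partial>\<mu>)"

text \<open>
  The double integral is an iterated one, since the measure is not assumed to be
  sigma-finite and the product measure need not behave well in that case.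
\<close>

definition mercer_kernel ::
  "(real^'d) set \<Rightarrow> (real^'d) measure \<Rightarrow> (real^'d \<Rightarrow> real^'d \<Rightarrow> real) \<Rightarrow> bool" where
  "mercer_kernel X \<mu> K \<longleftrightarrow>
     strictly_positive_borel X \<mu> \<and>
     continuous_on (X \<times> X) (\<lambda>(x, x'). K x x') \<and>
     (\<forall>x\<in>X. \<forall>x'\<in>X. K x x' = K x' x) \<and>
     (\<forall>g\<in>L2 \<mu>. 0 \<le> (\<integral>x'. (\<integral>x. K x x' * g x * g x' \<partial>\<mu>) \<partial>\<mu>)) \<and>
     (\<integral>\<^sup>+ x. ennreal \<bar>K x x\<bar> \<partial>\<mu>) < \<infinity>"

text \<open>
  The eigenvalue equation is one between elements of \<open>L2\<close>, hence almost everywhere;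
  the expansion of the kernel holds at every point.
\<close>

definition mercer_expansion ::
  "(real^'d) set \<Rightarrow> (real^'d) measure \<Rightarrow> (real^'d \<Rightarrow> real^'d \<Rightarrow> real) \<Rightarrow>
    ('l::finite \<Rightarrow> real) \<Rightarrow> ('l \<Rightarrow> real^'d \<Rightarrow> real) \<Rightarrow> bool" where
  "mercer_expansion X \<mu> K evals \<phi> \<longleftrightarrow>
     (\<forall>i. 0 \<le> evals i) \<and>
     (\<forall>i. \<phi> i \<in> L2 \<mu>) \<and>
     (\<forall>i j. (\<integral>x. \<phi> i x * \<phi> j x \<partial>\<mu>) = (if i = j then 1 else 0)) \<and>
     (\<forall>i. AE x in \<mu>. integral_operator \<mu> K (\<phi> i) x = evals i * \<phi> i x) \<and>
     (\<forall>x\<in>X. \<forall>x'\<in>X. K x x' = (\<Sum>i\<in>UNIV. evals i * \<phi> i x * \<phi> i x'))"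

section \<open>Quadrature and pseudospectral approximation\<close>

definition orthogonalizing_rule ::
  "'a set \<Rightarrow> 'a measure \<Rightarrow> ('n::finite \<Rightarrow> 'a) \<Rightarrow> ('n \<Rightarrow> real) \<Rightarrow> ('l::finite \<Rightarrow> 'a \<Rightarrow> real) \<Rightarrow> bool" where
  "orthogonalizing_rule X \<mu> xs w \<psi> \<longleftrightarrow>
     (\<forall>k. xs k \<in> X) \<and>
     (\<forall>i j. (\<Sum>k\<in>UNIV. w k * \<psi> i (xs k) * \<psi> j (xs k)) = (\<integral>x. \<psi> i x * \<psi> j x \<partial>\<mu>) \<and>
            (\<integral>x. \<psi> i x * \<psi> j x \<partial>\<mu>) = (if i = j then 1 else 0))"

definition pseudospectral ::
  "('n::finite \<Rightarrow> 'a) \<Rightarrow> ('n \<Rightarrow> real) \<Rightarrow> ('l::finite \<Rightarrow> 'a \<Rightarrow> real) \<Rightarrow> ('a \<Rightarrow> real) \<Rightarrow> 'a \<Rightarrow> real" where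
  "pseudospectral xs w \<psi> f x =
     (\<Sum>i\<in>UNIV. (\<Sum>k\<in>UNIV. w k * f (xs k) * \<psi> i (xs k)) * \<psi> i x)"

section \<open>Gaussian process regression\<close>

definition kernel_matrix :: "('a \<Rightarrow> 'a \<Rightarrow> real) \<Rightarrow> ('n::finite \<Rightarrow> 'a) \<Rightarrow> real^'n^'n" where
  "kernel_matrix K xs = (\<chi> i j. K (xs i) (xs j))"

definition gp_posterior_mean ::
  "('a \<Rightarrow> 'a \<Rightarrow> real) \<Rightarrow> real \<Rightarrow> ('n::finite \<Rightarrow> 'a) \<Rightarrow> real^'n \<Rightarrow> 'a \<Rightarrow> real" where
  "gp_posterior_mean K nugget xs y x =
     y \<bullet> (matrix_inv (\<chi> i j. K (xs i) (xs j) + (if i = j then nugget else 0)) *v (\<chi> k. K (xs k) x))"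

definition eigenvalues :: "real^'n^'n \<Rightarrow> real set" where
  "eigenvalues A = {s. \<exists>v. v \<noteq> 0 \<and> A *v v = s *\<^sub>R v}"

end

theory Submission
  imports Defs
begin

text \<open>
  Put \<open>z = R y\<close>, so that \<open>y = (K + \<sigma>\<^sup>2) z\<close>. Inserting this into the pseudospectral coefficients,
  the part \<open>K z\<close> is a combination of the vectors \<open>\<phi>\<^sub>i(x\<^sub>k)\<close> and is reproduced exactly by the
  orthogonalizing rule; it gives precisely the posterior mean. Hence the \<open>i\<close>-th coefficient of
  the difference is \<open>- \<sigma>\<^sup>2 \<Sum>\<^sub>k w\<^sub>k z\<^sub>k \<phi>\<^sub>i(x\<^sub>k)\<close>. Parseval and the Cauchy-Schwarz inequality reduce the
  claim to \<open>norm z \<le> norm y / (s\<^sub>N + \<sigma>\<^sup>2)\<close>, which is the variational characterization of \<open>s\<^sub>N\<close>.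
\<close>

section \<open>The smallest eigenvalue of a symmetric matrix\<close>

lemma symmetric_matrix_inner:
  fixes A :: "real^'n^'n"
  assumes "transpose A = A"
  shows "(A *v u) \<bullet> v = u \<bullet> (A *v v)"
  by (metis assms dot_lmul_matrix transpose_matrix_vector)

lemma matrix_mul_matrix_inv:
  assumes "invertible A"
  shows "A ** matrix_inv A = mat 1"
proof -
  have "A ** matrix_inv A = mat 1 \<and> matrix_inv A ** A = mat 1"
    using assms unfolding invertible_def matrix_inv_def by (rule someI_ex)
  then show ?thesis ..
qed

text \<open>Symmetry of \<open>A\<close> is applied to the preimages of \<open>u\<close> and
  \<open>v\<close>. In the posterior mean this moves the inverse from the kernel vector onto the
  data.\<close>

lemma inner_matrix_inv_symmetric:
  fixes A :: "real^'n^'n"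
  assumes "transpose A = A" "invertible A"
  shows "u \<bullet> (matrix_inv A *v v) = (matrix_inv A *v u) \<bullet> v"
proof -
  have id: "A *v (matrix_inv A *v x) = x" for x
    by (metis assms(2) matrix_mul_matrix_inv matrix_vector_mul_assoc matrix_vector_mul_lid)
  show ?thesis
    using symmetric_matrix_inner[OF assms(1), of "matrix_inv A *v u" "matrix_inv A *v v"]
    by (simp only: id)
qed

text \<open>Eigenvectors for distinct eigenvalues are orthogonal, and an orthogonal family in finite
  dimension is finite. This is what makes \<open>Min\<close> of the spectrum meaningful.\<close>

lemma finite_eigenvalues_symmetric:
  fixes A :: "real^'n^'n"
  assumes "transpose A = A"
  shows "finite (eigenvalues A)"
proof -
  define e where "e s = (SOME v. v \<noteq> 0 \<and> A *v v = s *\<^sub>R v)" for s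
  have e: "e s \<noteq> 0 \<and> A *v e s = s *\<^sub>R e s" if "s \<in> eigenvalues A" for s
    using that unfolding e_def eigenvalues_def mem_Collect_eq by (rule someI_ex)
  have orth: "e s \<bullet> e t = 0" if "s \<in> eigenvalues A" "t \<in> eigenvalues A" "s \<noteq> t" for s t
    using symmetric_matrix_inner[OF assms, of "e s" "e t"] e that by simp
  \<comment> \<open>A vector chosen for two different eigenvalues would be orthogonal to itself,
    hence zero.\<close>
  have "inj_on e (eigenvalues A)"
    using e orth by (metis inj_onI inner_eq_zero_iff)
  moreover have "pairwise orthogonal (e ` eigenvalues A)"
    using orth by (fastforce simp: pairwise_def orthogonal_def)
  then have "finite (e ` eigenvalues A)"
    by (rule pairwise_orthogonal_imp_finite)
  ultimately show ?thesis
    using finite_imageD by blast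
qed

text \<open>Moving from \<open>v\<close> in the direction \<open>b = B *v v\<close> changes the form
  to first order by \<open>2 * t * (b \<bullet> b)\<close>. For small negative \<open>t\<close> this
  would make the form negative unless \<open>b = 0\<close>.\<close>

lemma positive_semidefinite_inner_zero:
  fixes B :: "real^'n^'n"
  assumes sym: "transpose B = B" and psd: "\<And>x. 0 \<le> x \<bullet> (B *v x)" and v: "v \<bullet> (B *v v) = 0"
  shows "B *v v = 0"
proof -
  define b where "b = B *v v"
  define q where "q = b \<bullet> (B *v b)"
  have nonneg: "0 \<le> 2 * t * (b \<bullet> b) + t\<^sup>2 * q" for t
  proof -
    have vb: "v \<bullet> (B *v b) = b \<bullet> b"
      using symmetric_matrix_inner[OF sym, of v b] by (simp add: b_def)
    have "0 \<le> (v + t *\<^sub>R b) \<bullet> (B *v (v + t *\<^sub>R b))"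
      by (rule psd)
    also have "\<dots> = 2 * t * (b \<bullet> b) + t\<^sup>2 * q"
      using v vb unfolding q_def
      by (simp add: matrix_vector_right_distrib inner_add_left inner_add_right matrix_vector_mult_scaleR power2_eq_square
          algebra_simps flip: b_def)
    finally show ?thesis .
  qed
  have "b \<bullet> b = 0"
  proof (rule ccontr)
    assume "b \<bullet> b \<noteq> 0"
    then have pos: "0 < b \<bullet> b"
      by simp
    have q: "0 \<le> q"
      unfolding q_def by (rule psd)
    \<comment> \<open>The \<open>1\<close> keeps the denominator positive when \<open>q = 0\<close>;
      with this \<open>t\<close> the quadratic becomes \<open>t * (b \<bullet> b - t)\<close>, a
      negative times a positive number.\<close>
    define t where "t = - (b \<bullet> b) / (q + 1)"
    have tq: "t * (q + 1) = - (b \<bullet> b)"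
      using q by (simp add: t_def)
    have "t < 0"
      using pos q by (simp add: t_def divide_neg_pos)
    have "2 * t * (b \<bullet> b) + t\<^sup>2 * q = t * (2 * (b \<bullet> b) + t * (q + 1) - t)"
      by (simp add: power2_eq_square algebra_simps)
    also have "\<dots> = t * (b \<bullet> b - t)"
      by (simp add: tq)
    also have "\<dots> < 0"
      using \<open>t < 0\<close> pos by (intro mult_neg_pos) linarith+
    finally show False
      using nonneg[of t] by simp
  qed
  then show ?thesis
    by (simp add: b_def)
qed

text \<open>
  If \<open>v\<close> minimizes the form on the unit sphere, with value \<open>s\<close>, then \<open>A - s\<close> is positive
  semidefinite and its form vanishes at \<open>v\<close>, so \<open>v\<close> is an eigenvector.
\<close>

lemma least_eigenvalue_symmetric:
  fixes A :: "real^'n^'n"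
  assumes sym: "transpose A = A"
  obtains s where "s \<in> eigenvalues A" "\<And>x. s * (norm x)\<^sup>2 \<le> x \<bullet> (A *v x)"
proof -
  have "continuous_on (sphere 0 1) (\<lambda>x. x \<bullet> (A *v x))"
    by (intro continuous_intros linear_continuous_on) (simp add: linear_linear)
  moreover have "sphere (0 :: real^'n) 1 \<noteq> {}"
    by simp
  ultimately have "\<exists>v\<in>sphere 0 1. \<forall>x\<in>sphere 0 1. v \<bullet> (A *v v) \<le> x \<bullet> (A *v x)"
    by (intro continuous_attains_inf compact_sphere)
  then obtain v where v: "norm v = 1"
    and min: "\<And>x. norm x = 1 \<Longrightarrow> v \<bullet> (A *v v) \<le> x \<bullet> (A *v x)"
    by auto
  define s where "s = v \<bullet> (A *v v)"
  have bound: "s * (norm x)\<^sup>2 \<le> x \<bullet> (A *v x)" for x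
  proof (cases "x = 0")
    case False
    define u where "u = x /\<^sub>R norm x"
    have "s \<le> u \<bullet> (A *v u)"
      unfolding s_def using False by (intro min) (simp add: u_def)
    then have "(norm x)\<^sup>2 * s \<le> (norm x)\<^sup>2 * (u \<bullet> (A *v u))"
      by (simp add: mult_left_mono)
    also have "\<dots> = (norm x *\<^sub>R u) \<bullet> (A *v (norm x *\<^sub>R u))"
      by (simp add: matrix_vector_mult_scaleR power2_eq_square)
    also have "norm x *\<^sub>R u = x"
      using False by (simp add: u_def)
    finally show ?thesis
      by (simp add: mult.commute)
  qed simp
  define B where "B = A - s *\<^sub>R mat 1"
  have B: "B *v x = A *v x - s *\<^sub>R x" for x
    by (simp add: B_def matrix_vector_mult_diff_rdistrib flip: scaleR_matrix_vector_assoc)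
  have "transpose B = B"
    using sym by (simp add: B_def transpose_def mat_def vec_eq_iff)
  moreover have "0 \<le> x \<bullet> (B *v x)" for x
    using bound[of x] by (simp add: B inner_diff_right power2_norm_eq_inner)
  moreover have "v \<bullet> (B *v v) = 0"
    using v by (simp add: B inner_diff_right s_def flip: power2_norm_eq_inner)
  ultimately have "B *v v = 0"
    by (rule positive_semidefinite_inner_zero)
  then have "s \<in> eigenvalues A"
    using v unfolding eigenvalues_def by (intro CollectI exI[of _ v]) (auto simp: B)
  with bound that show thesis
    by blast
qed

text \<open>The spectrum is finite and contains some \<open>s\<close> bounding the form from below;
  the bound passes to \<open>Min\<close>, which is at most \<open>s\<close>.\<close>

lemma Min_eigenvalues_symmetric:
  fixes A :: "real^'n^'n"
  assumes sym: "transpose A = A"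
  shows "Min (eigenvalues A) \<in> eigenvalues A"
    and "Min (eigenvalues A) * (norm x)\<^sup>2 \<le> x \<bullet> (A *v x)"
proof -
  obtain s where s: "s \<in> eigenvalues A" "\<And>x. s * (norm x)\<^sup>2 \<le> x \<bullet> (A *v x)"
    using least_eigenvalue_symmetric[OF sym] by metis
  note fin = finite_eigenvalues_symmetric[OF sym]
  show "Min (eigenvalues A) \<in> eigenvalues A"
    using fin s(1) by (intro Min_in) auto
  have "Min (eigenvalues A) * (norm x)\<^sup>2 \<le> s * (norm x)\<^sup>2"
    using fin s(1) by (intro mult_right_mono Min_le) auto
  also have "\<dots> \<le> x \<bullet> (A *v x)"
    by (rule s(2))
  finally show "Min (eigenvalues A) * (norm x)\<^sup>2 \<le> x \<bullet> (A *v x)" .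
qed

text \<open>The form at an eigenvector is the eigenvalue times a positive number.\<close>

lemma Min_eigenvalues_nonneg:
  fixes A :: "real^'n^'n"
  assumes sym: "transpose A = A" and psd: "\<And>x. 0 \<le> x \<bullet> (A *v x)"
  shows "0 \<le> Min (eigenvalues A)"
proof -
  obtain v where v: "v \<noteq> 0" "A *v v = Min (eigenvalues A) *\<^sub>R v"
    using Min_eigenvalues_symmetric(1)[OF sym] unfolding eigenvalues_def by auto
  show ?thesis
    using psd[of v] v inner_gt_zero_iff[of v]
    by (auto simp: zero_le_mult_iff simp del: inner_gt_zero_iff)
qed

section \<open>Parseval's identity for finite orthonormal families\<close>

text \<open>The product is dominated by the sum of the two squares.\<close>

lemma integrable_mult_L2:
  assumes "g \<in> L2 \<mu>" "h \<in> L2 \<mu>"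
  shows "integrable \<mu> (\<lambda>x. g x * h x)"
proof (rule Bochner_Integration.integrable_bound)
  show "integrable \<mu> (\<lambda>x. (g x)\<^sup>2 + (h x)\<^sup>2)"
    using assms by (simp add: L2_def)
  show "(\<lambda>x. g x * h x) \<in> borel_measurable \<mu>"
    using assms by (intro borel_measurable_times) (auto simp: L2_def)
  have "norm (a * b) \<le> norm (a\<^sup>2 + b\<^sup>2)" for a b :: real
  proof -
    have "2 * (\<bar>a\<bar> * \<bar>b\<bar>) \<le> a\<^sup>2 + b\<^sup>2"
      using sum_squares_bound[of "\<bar>a\<bar>" "\<bar>b\<bar>"] by (simp add: mult.assoc)
    moreover have "0 \<le> \<bar>a\<bar> * \<bar>b\<bar>"
      by simp
    ultimately show ?thesis
      unfolding real_norm_def abs_mult by linarith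
  qed
  then show "AE x in \<mu>. norm (g x * h x) \<le> norm ((g x)\<^sup>2 + (h x)\<^sup>2)"
    by simp
qed

text \<open>The square is expanded into a finite double sum; integrability of the products allows
  termwise integration, and orthonormality leaves the diagonal.\<close>

lemma L2_norm_orthonormal_sum:
  fixes \<phi> :: "'l::finite \<Rightarrow> 'a \<Rightarrow> real"
  assumes L2: "\<And>i. \<phi> i \<in> L2 \<mu>"
    and orth: "\<And>i j. (\<integral>x. \<phi> i x * \<phi> j x \<partial>\<mu>) = (if i = j then 1 else 0)"
  shows "(L2_norm \<mu> (\<lambda>x. \<Sum>i\<in>UNIV. c i * \<phi> i x))\<^sup>2 = (\<Sum>i\<in>UNIV. (c i)\<^sup>2)"
proof -
  have "(L2_norm \<mu> (\<lambda>x. \<Sum>i\<in>UNIV. c i * \<phi> i x))\<^sup>2 = (\<integral>x. (\<Sum>i\<in>UNIV. c i * \<phi> i x)\<^sup>2 \<partial>\<mu>)"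
    by (simp add: L2_norm_def)
  also have "\<dots> = (\<integral>x. (\<Sum>i\<in>UNIV. \<Sum>j\<in>UNIV. (c i * c j) * (\<phi> i x * \<phi> j x)) \<partial>\<mu>)"
    by (simp add: power2_eq_square sum_product ac_simps)
  also have "\<dots> = (\<Sum>i\<in>UNIV. \<Sum>j\<in>UNIV. (c i * c j) * (if i = j then 1 else 0))"
    by (simp add: integrable_mult_L2[OF L2 L2] orth)
  also have "\<dots> = (\<Sum>i\<in>UNIV. (c i)\<^sup>2)"
    by (simp add: power2_eq_square if_distrib cong: if_cong)
  finally show ?thesis .
qed

theorem corollary5p2:
  fixes X :: "(real^'d) set"
    and \<mu> :: "(real^'d) measure"
    and K :: "real^'d \<Rightarrow> real^'d \<Rightarrow> real"
    and evals :: "'l::finite \<Rightarrow> real"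
    and \<phi> :: "'l \<Rightarrow> real^'d \<Rightarrow> real"
    and xs :: "'n::finite \<Rightarrow> real^'d"
    and w :: "'n \<Rightarrow> real"
    and f :: "real^'d \<Rightarrow> real"
    and y :: "real^'n"
    and \<sigma> M w_max s_N :: real
  assumes "mercer_kernel X \<mu> K"
    and "mercer_expansion X \<mu> K evals \<phi>"
    and "orthogonalizing_rule X \<mu> xs w \<phi>"
    and "y = (\<chi> k. f (xs k))"
    and "0 < \<sigma>\<^sup>2"
    and "M = Max (range (\<lambda>(k, i). \<bar>\<phi> i (xs k)\<bar>))"
    and "w_max = Max (range (\<lambda>k. \<bar>w k\<bar>))"
    and "s_N = Min (eigenvalues (kernel_matrix K xs))"
  shows "(L2_norm \<mu> (\<lambda>x. gp_posterior_mean K (\<sigma>\<^sup>2) xs y x - pseudospectral xs w \<phi> f x))\<^sup>2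
    \<le> (norm y)\<^sup>2 * real CARD('l) * real CARD('n) * M\<^sup>2 * w_max\<^sup>2 * (\<sigma>\<^sup>2 / (s_N + \<sigma>\<^sup>2))\<^sup>2"
proof -

  \<comment> \<open>Notation and consequences of the hypotheses\<close>
  define G where "G = kernel_matrix K xs"
  define A where "A = (\<chi> i j. K (xs i) (xs j) + (if i = j then \<sigma>\<^sup>2 else 0))"
  define z where "z = matrix_inv A *v y"
  \<comment> \<open>The numbers \<open>evals i * a i\<close> will be the coefficients of the
    posterior mean, and \<open>c i\<close> those of its difference from the pseudospectral
    approximation.\<close>
  define a where "a i = (\<Sum>k\<in>UNIV. z $ k * \<phi> i (xs k))" for i
  define c where "c i = - \<sigma>\<^sup>2 * (\<Sum>k\<in>UNIV. w k * \<phi> i (xs k) * z $ k)" for i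
  have evals: "0 \<le> evals i" for i
    using assms(2) by (simp add: mercer_expansion_def)
  have L2: "\<phi> i \<in> L2 \<mu>" for i
    using assms(2) by (simp add: mercer_expansion_def)
  have orth: "(\<integral>x. \<phi> i x * \<phi> j x \<partial>\<mu>) = (if i = j then 1 else 0)" for i j
    using assms(2) by (simp add: mercer_expansion_def)
  have K: "K x x' = (\<Sum>i\<in>UNIV. evals i * \<phi> i x * \<phi> i x')" if "x \<in> X" "x' \<in> X" for x x'
    using assms(2) that by (simp add: mercer_expansion_def)
  have xs: "xs k \<in> X" for k
    using assms(3) by (simp add: orthogonalizing_rule_def)
  have quad: "(\<Sum>k\<in>UNIV. w k * \<phi> i (xs k) * \<phi> j (xs k)) = (if i = j then 1 else 0)" for i j
    using assms(3) by (simp add: orthogonalizing_rule_def)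
  \<comment> \<open>The kernel expansion holds on \<open>X\<close> only, so the integrals must be
    known to run over \<open>X\<close>.\<close>
  have space: "space \<mu> = X"
    using assms(1) sets_eq_imp_space_eq[of \<mu> "restrict_space borel X"]
    by (simp add: mercer_kernel_def strictly_positive_borel_def space_restrict_space)

  \<comment> \<open>The kernel matrix and its smallest eigenvalue\<close>
  have sum_K: "(\<Sum>k\<in>UNIV. v $ k * K (xs k) x)
      = (\<Sum>i\<in>UNIV. evals i * (\<Sum>k\<in>UNIV. v $ k * \<phi> i (xs k)) * \<phi> i x)"
    if "x \<in> X" for x and v :: "real^'n"
  proof -
    have "(\<Sum>k\<in>UNIV. v $ k * K (xs k) x)
        = (\<Sum>k\<in>UNIV. \<Sum>i\<in>UNIV. evals i * (v $ k * \<phi> i (xs k)) * \<phi> i x)"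
      by (simp add: K xs that sum_distrib_left ac_simps)
    also have "\<dots> = (\<Sum>i\<in>UNIV. \<Sum>k\<in>UNIV. evals i * (v $ k * \<phi> i (xs k)) * \<phi> i x)"
      by (rule sum.swap)
    finally show ?thesis
      by (simp add: sum_distrib_left sum_distrib_right)
  qed
  have K_commute: "K (xs j) (xs k) = K (xs k) (xs j)" for j k
    using assms(1) xs by (simp add: mercer_kernel_def)
  have G_mult: "(G *v v) $ j
      = (\<Sum>i\<in>UNIV. evals i * (\<Sum>k\<in>UNIV. v $ k * \<phi> i (xs k)) * \<phi> i (xs j))" for v j
    unfolding sum_K[OF xs, symmetric]
    by (simp add: G_def kernel_matrix_def matrix_vector_mult_def K_commute[of j] mult.commute)
  have G_sym: "transpose G = G"
    by (simp add: G_def kernel_matrix_def transpose_def vec_eq_iff K_commute)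
  \<comment> \<open>The expansion turns the form into a sum of squares weighted by the nonnegative
    \<open>evals i\<close>.\<close>
  have G_psd: "0 \<le> v \<bullet> (G *v v)" for v
  proof -
    have "v \<bullet> (G *v v)
        = (\<Sum>j\<in>UNIV. \<Sum>i\<in>UNIV. evals i * (\<Sum>k\<in>UNIV. v $ k * \<phi> i (xs k)) * (v $ j * \<phi> i (xs j)))"
      by (simp add: inner_vec_def G_mult sum_distrib_left ac_simps)
    also have "\<dots>
        = (\<Sum>i\<in>UNIV. \<Sum>j\<in>UNIV. evals i * (\<Sum>k\<in>UNIV. v $ k * \<phi> i (xs k)) * (v $ j * \<phi> i (xs j)))"
      by (rule sum.swap)
    also have "\<dots> = (\<Sum>i\<in>UNIV. evals i * (\<Sum>k\<in>UNIV. v $ k * \<phi> i (xs k))\<^sup>2)"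
      by (simp add: power2_eq_square mult.assoc flip: sum_distrib_left)
    also have "0 \<le> \<dots>"
      by (intro sum_nonneg mult_nonneg_nonneg evals) simp
    finally show ?thesis .
  qed
  have s_N: "0 \<le> s_N" "s_N * (norm x)\<^sup>2 \<le> x \<bullet> (G *v x)" for x
    using Min_eigenvalues_nonneg[OF G_sym G_psd] Min_eigenvalues_symmetric(2)[OF G_sym] assms(8)
    by (simp_all add: G_def)
  have pos: "0 < s_N + \<sigma>\<^sup>2"
    using s_N(1) assms(5) by (rule add_nonneg_pos)

  \<comment> \<open>The matrix with nugget and the bound on \<open>z\<close>\<close>
  have A: "A *v v = G *v v + \<sigma>\<^sup>2 *\<^sub>R v" for v
  proof -
    have "A = G + \<sigma>\<^sup>2 *\<^sub>R mat 1"
      by (simp add: A_def G_def kernel_matrix_def mat_def vec_eq_iff)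
    then show ?thesis
      by (simp add: matrix_vector_mult_add_rdistrib flip: scaleR_matrix_vector_assoc)
  qed
  have A_sym: "transpose A = A"
    by (auto simp: A_def transpose_def vec_eq_iff intro: K_commute)
  have A_bound: "(s_N + \<sigma>\<^sup>2) * (norm v)\<^sup>2 \<le> v \<bullet> (A *v v)" for v
    using s_N(2)[of v] by (simp add: A inner_add_right algebra_simps power2_norm_eq_inner)
  \<comment> \<open>The lower bound on the form is strictly positive off zero, so the square matrix
    \<open>A\<close> has trivial kernel and \<open>matrix_inv A\<close> is a true inverse.\<close>
  have "v = 0" if "A *v v = 0" for v
    using A_bound[of v] pos that by (simp add: mult_le_0_iff)
  then have inv: "invertible A"
    using matrix_left_invertible_ker[of A] invertible_left_inverse[of A] by blast
  have Az: "A *v z = y"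
    unfolding z_def by (metis inv matrix_mul_matrix_inv matrix_vector_mul_assoc matrix_vector_mul_lid)
  have norm_z: "(s_N + \<sigma>\<^sup>2) * norm z \<le> norm y"
  proof (cases "z = 0")
    case False
    have "(s_N + \<sigma>\<^sup>2) * norm z * norm z \<le> z \<bullet> y"
      using A_bound[of z] by (simp add: Az power2_eq_square mult.assoc)
    also have "\<dots> \<le> norm y * norm z"
      using norm_cauchy_schwarz[of z y] by (simp add: mult.commute)
    finally show ?thesis
      using False by simp
  qed simp

  \<comment> \<open>Coefficients in the eigenfunction basis\<close>
  have mean: "gp_posterior_mean K (\<sigma>\<^sup>2) xs y x = (\<Sum>i\<in>UNIV. evals i * a i * \<phi> i x)" if "x \<in> X" for x
  proof -
    have "gp_posterior_mean K (\<sigma>\<^sup>2) xs y x = z \<bullet> (\<chi> k. K (xs k) x)"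
      unfolding gp_posterior_mean_def A_def[symmetric] z_def
      by (rule inner_matrix_inv_symmetric[OF A_sym inv])
    also have "\<dots> = (\<Sum>i\<in>UNIV. evals i * a i * \<phi> i x)"
      by (simp add: inner_vec_def sum_K[OF that] a_def)
    finally show ?thesis .
  qed
  have coeff: "(\<Sum>k\<in>UNIV. w k * f (xs k) * \<phi> i (xs k)) = evals i * a i - c i" for i
  proof -
    \<comment> \<open>This is row \<open>k\<close> of \<open>A *v z = y\<close>, with the kernel
      part expanded in eigenfunctions.\<close>
    have f: "f (xs k) = (\<Sum>j\<in>UNIV. evals j * a j * \<phi> j (xs k)) + \<sigma>\<^sup>2 * z $ k" for k
      using arg_cong[OF Az, of "\<lambda>v. v $ k"] by (simp add: A G_mult a_def assms(4))
    have "(\<Sum>k\<in>UNIV. w k * f (xs k) * \<phi> i (xs k))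
        = (\<Sum>k\<in>UNIV. \<Sum>j\<in>UNIV. evals j * a j * (w k * \<phi> i (xs k) * \<phi> j (xs k))) - c i"
      by (simp add: f c_def algebra_simps sum.distrib sum_distrib_left sum_negf)
    also have "(\<Sum>k\<in>UNIV. \<Sum>j\<in>UNIV. evals j * a j * (w k * \<phi> i (xs k) * \<phi> j (xs k)))
        = (\<Sum>j\<in>UNIV. \<Sum>k\<in>UNIV. evals j * a j * (w k * \<phi> i (xs k) * \<phi> j (xs k)))"
      by (rule sum.swap)
    \<comment> \<open>Discrete orthogonality makes the inner sum over nodes a Kronecker
      delta.\<close>
    also have "\<dots> = evals i * a i"
      by (simp add: quad if_distrib cong: if_cong flip: sum_distrib_left)
    finally show ?thesis .
  qed

  \<comment> \<open>Estimate of the error\<close>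
  have "L2_norm \<mu> (\<lambda>x. gp_posterior_mean K (\<sigma>\<^sup>2) xs y x - pseudospectral xs w \<phi> f x)
      = L2_norm \<mu> (\<lambda>x. \<Sum>i\<in>UNIV. c i * \<phi> i x)"
    unfolding L2_norm_def
    by (intro arg_cong[where f = sqrt] Bochner_Integration.integral_cong refl)
      (simp add: space mean pseudospectral_def coeff left_diff_distrib sum_subtractf)
  then have "(L2_norm \<mu> (\<lambda>x. gp_posterior_mean K (\<sigma>\<^sup>2) xs y x - pseudospectral xs w \<phi> f x))\<^sup>2
      = (\<Sum>i\<in>UNIV. (c i)\<^sup>2)"
    by (simp add: L2_norm_orthonormal_sum[OF L2 orth])
  also have "\<dots> \<le> (\<Sum>i\<in>(UNIV :: 'l set).
      (\<sigma>\<^sup>2)\<^sup>2 * (real CARD('n) * M\<^sup>2 * w_max\<^sup>2 * (norm z)\<^sup>2))"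
  proof (rule sum_mono)
    fix i :: 'l
    have entry: "(w k * \<phi> i (xs k))\<^sup>2 \<le> M\<^sup>2 * w_max\<^sup>2" for k
    proof -
      have "\<bar>\<phi> i (xs k)\<bar> \<le> M"
        unfolding assms(6) by (rule Max_ge) (auto intro: rev_image_eqI[of "(k, i)"])
      moreover have "\<bar>w k\<bar> \<le> w_max"
        unfolding assms(7) by simp
      ultimately have "(\<phi> i (xs k))\<^sup>2 \<le> M\<^sup>2" "(w k)\<^sup>2 \<le> w_max\<^sup>2"
        using power_mono[of "\<bar>\<phi> i (xs k)\<bar>" M 2] power_mono[of "\<bar>w k\<bar>" w_max 2] by simp_all
      then have "(\<phi> i (xs k))\<^sup>2 * (w k)\<^sup>2 \<le> M\<^sup>2 * w_max\<^sup>2"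
        by (intro mult_mono) simp_all
      then show ?thesis
        by (simp add: power_mult_distrib mult.commute)
    qed
    \<comment> \<open>Weights are grouped with basis values, so that \<open>z\<close> enters only
      through its norm; the other factor has one term per node, each at most
      \<open>M\<^sup>2 * w_max\<^sup>2\<close>.\<close>
    have "(\<Sum>k\<in>UNIV. w k * \<phi> i (xs k) * z $ k)\<^sup>2
        \<le> (\<Sum>k\<in>UNIV. (w k * \<phi> i (xs k))\<^sup>2) * (\<Sum>k\<in>UNIV. (z $ k)\<^sup>2)"
      by (rule Cauchy_Schwarz_ineq_sum)
    also have "(\<Sum>k\<in>UNIV. (z $ k)\<^sup>2) = (norm z)\<^sup>2"
      unfolding power2_norm_eq_inner inner_vec_def by (simp add: power2_eq_square)
    also have "(\<Sum>k\<in>UNIV. (w k * \<phi> i (xs k))\<^sup>2) * (norm z)\<^sup>2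
        \<le> (real CARD('n) * (M\<^sup>2 * w_max\<^sup>2)) * (norm z)\<^sup>2"
      by (intro mult_right_mono sum_bounded_above entry) simp
    finally show "(c i)\<^sup>2 \<le> (\<sigma>\<^sup>2)\<^sup>2 * (real CARD('n) * M\<^sup>2 * w_max\<^sup>2 * (norm z)\<^sup>2)"
      unfolding c_def power_mult_distrib power2_minus by (simp add: mult_left_mono mult.assoc)
  qed
  also have "\<dots> = real CARD('l) * real CARD('n) * M\<^sup>2 * w_max\<^sup>2 * (\<sigma>\<^sup>2)\<^sup>2 * (norm z)\<^sup>2"
    by simp
  also have "\<dots> \<le> real CARD('l) * real CARD('n) * M\<^sup>2 * w_max\<^sup>2 * (\<sigma>\<^sup>2)\<^sup>2
      * (norm y / (s_N + \<sigma>\<^sup>2))\<^sup>2"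
    using norm_z pos by (intro mult_left_mono power_mono) (simp_all add: field_simps)
  also have "\<dots> = (norm y)\<^sup>2 * real CARD('l) * real CARD('n) * M\<^sup>2 * w_max\<^sup>2
      * (\<sigma>\<^sup>2 / (s_N + \<sigma>\<^sup>2))\<^sup>2"
    by (simp add: power_divide)
  finally show ?thesis .
qed

end
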